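(* The joint spatial channel selection and mobility game, in which each user $n\in\mathcal{N}$ chooses a location and channel pair $(d_n,a_n)\in\Delta_n\times\mathcal{M}$ and has payoff $U_n(\boldsymbol{d},\boldsymbol{a})$, has a Nash equilibrium and the finite improvement property.
   Context: Users $\mathcal{N}=\{1,\dots,N\}$; channels $\mathcal{M}=\{1,\dots,M\}$; $\Delta$ is a finite set of locations with a distance $\|\cdot,\cdot\|$; $\Delta_n\subseteq\Delta$ is the (nonempty) location selection space of user $n$; $\delta$ is the transmission range. For $\boldsymbol{d}\in\Delta_1\times\dots\times\Delta_N$, $\mathcal{N}_n(\boldsymbol{d})=\{i\in\mathcal{N}:i\ne n,\ \|d_i,d_n\|\le\delta\}$. Parameters: $\theta_m\in(0,1)$; mean data rates $B_{m,d}^n>0$; fixed contention probabilities $p_n\in(p_{\min},p_{\max})$ with $0<p_{\min}<p_{\max}<1$. For $\boldsymbol{a}\in\mathcal{M}^N$, $\mathcal{N}_n^{a_n}(\boldsymbol{d},\boldsymbol{a})=\{i\in\mathcal{N}_n(\boldsymbol{d}):a_i=a_n\}$, and $$U_n(\boldsymbol{d},\boldsymbol{a})=\log\Big(\theta_{a_n}B_{a_n,d_n}^n p_n\prod_{i\in\mathcal{N}_n^{a_n}(\boldsymbol{d},\boldsymbol{a})}(1-p_i)\Big).$$ A Nash equilibrium is a profile $(\boldsymbol{d}^*,\boldsymbol{a}^* )$ with $(d_n^*,a_n^* )\in\arg\max_{d_n\in\Delta_n,a_n\in\mathcal{M}}U_n(d_n,d_{-n}^*,a_n,a_{-n}^*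 )$ for all $n\in\mathcal{N}$. A better response update is a change by a single player of its own action (location and channel pair) that strictly increases its own payoff. The finite improvement property: any asynchronous better response update process (no more than one player updates at any given time) terminates at a pure Nash equilibrium within a finite number of updates. *)

theory Defs
  imports "HOL-Analysis.Analysis"
begin

text \<open>
  Strategic-form games: \<open>I\<close> is the set of players, \<open>S i\<close> the action set of player \<open>i\<close>, and
  \<open>u i s\<close> the payoff of player \<open>i\<close> at the action profile \<open>s \<in> Pi\<^sub>E I S\<close>.
\<close>

definition nash_equilibrium ::
  "'i set \<Rightarrow> ('i \<Rightarrow> 'x set) \<Rightarrow> ('i \<Rightarrow> ('i \<Rightarrow> 'x) \<Rightarrow> real) \<Rightarrow> ('i \<Rightarrow> 'x) \<Rightarrow> bool" where
  "nash_equilibrium I S u s \<longleftrightarrow>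
     s \<in> Pi\<^sub>E I S \<and>
     (\<forall>i\<in>I. is_arg_max (\<lambda>x. u i (s(i := x))) (\<lambda>x. x \<in> S i) (s i))"

definition better_response_update ::
  "'i set \<Rightarrow> ('i \<Rightarrow> 'x set) \<Rightarrow> ('i \<Rightarrow> ('i \<Rightarrow> 'x) \<Rightarrow> real)
     \<Rightarrow> ('i \<Rightarrow> 'x) \<Rightarrow> ('i \<Rightarrow> 'x) \<Rightarrow> bool" where
  "better_response_update I S u s s' \<longleftrightarrow>
     s \<in> Pi\<^sub>E I S \<and> (\<exists>i\<in>I. \<exists>x\<in>S i. s' = s(i := x) \<and> u i s < u i s')"

text \<open>At each time slot at most one player updates; slots without an update are allowed.\<close>

definition better_response_process ::
  "'i set \<Rightarrow> ('i \<Rightarrow> 'x set) \<Rightarrow> ('i \<Rightarrow> ('i \<Rightarrow> 'x) \<Rightarrow> real) \<Rightarrow> (nat \<Rightarrow> 'i \<Rightarrow> 'x) \<Rightarrow> bool" where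
  "better_response_process I S u f \<longleftrightarrow>
     f 0 \<in> Pi\<^sub>E I S \<and>
     (\<forall>t. f (Suc t) = f t \<or> better_response_update I S u (f t) (f (Suc t)))"

text \<open>
  A better response update always changes the profile, so the updates of a process \<open>f\<close> are
  exactly the slots \<open>t\<close> with \<open>f (Suc t) \<noteq> f t\<close>. Every process makes only finitely many of
  them. Since idle slots are allowed, ending at an equilibrium can only be asked of processes
  that do not stay idle forever while some player still has a better response.
\<close>

definition finite_improvement_property ::
  "'i set \<Rightarrow> ('i \<Rightarrow> 'x set) \<Rightarrow> ('i \<Rightarrow> ('i \<Rightarrow> 'x) \<Rightarrow> real) \<Rightarrow> bool" where
  "finite_improvement_property I S u \<longleftrightarrow>
     (\<forall>f. better_response_process I S u f \<longrightarrow>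
        finite {t. f (Suc t) \<noteq> f t} \<and>
        ((\<forall>t. (\<exists>s'. better_response_update I S u (f t) s') \<longrightarrow> (\<exists>t'\<ge>t. f (Suc t') \<noteq> f t'))
           \<longrightarrow> (\<exists>T. nash_equilibrium I S u (f T) \<and> (\<forall>t\<ge>T. f t = f T))))"

definition neighbours ::
  "nat \<Rightarrow> ('l \<Rightarrow> 'l \<Rightarrow> real) \<Rightarrow> real \<Rightarrow> (nat \<Rightarrow> 'l) \<Rightarrow> nat \<Rightarrow> nat set" where
  "neighbours N ds \<delta> d n = {i \<in> {1..N}. i \<noteq> n \<and> ds (d i) (d n) \<le> \<delta>}"

definition cochannel_neighbours ::
  "nat \<Rightarrow> ('l \<Rightarrow> 'l \<Rightarrow> real) \<Rightarrow> real \<Rightarrow> (nat \<Rightarrow> 'l) \<Rightarrow> (nat \<Rightarrow> nat) \<Rightarrow> nat \<Rightarrow> nat set" where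
  "cochannel_neighbours N ds \<delta> d a n = {i \<in> neighbours N ds \<delta> d n. a i = a n}"

text \<open>\<open>B m l n\<close> is the mean data rate of user \<open>n\<close> on channel \<open>m\<close> at location \<open>l\<close>.\<close>

definition payoff ::
  "nat \<Rightarrow> ('l \<Rightarrow> 'l \<Rightarrow> real) \<Rightarrow> real \<Rightarrow> (nat \<Rightarrow> real) \<Rightarrow> (nat \<Rightarrow> 'l \<Rightarrow> nat \<Rightarrow> real)
     \<Rightarrow> (nat \<Rightarrow> real) \<Rightarrow> nat \<Rightarrow> (nat \<Rightarrow> 'l) \<Rightarrow> (nat \<Rightarrow> nat) \<Rightarrow> real" where
  "payoff N ds \<delta> \<theta> B p n d a =
     ln (\<theta> (a n) * B (a n) (d n) n * p n * (\<Prod>i\<in>cochannel_neighbours N ds \<delta> d a n. 1 - p i))"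

definition joint_actions :: "nat \<Rightarrow> (nat \<Rightarrow> 'l set) \<Rightarrow> nat \<Rightarrow> ('l \<times> nat) set" where
  "joint_actions M \<Delta>s n = \<Delta>s n \<times> {1..M}"

definition joint_payoff ::
  "nat \<Rightarrow> ('l \<Rightarrow> 'l \<Rightarrow> real) \<Rightarrow> real \<Rightarrow> (nat \<Rightarrow> real) \<Rightarrow> (nat \<Rightarrow> 'l \<Rightarrow> nat \<Rightarrow> real)
     \<Rightarrow> (nat \<Rightarrow> real) \<Rightarrow> nat \<Rightarrow> (nat \<Rightarrow> 'l \<times> nat) \<Rightarrow> real" where
  "joint_payoff N ds \<delta> \<theta> B p n s = payoff N ds \<delta> \<theta> B p n (\<lambda>i. fst (s i)) (\<lambda>i. snd (s i))"

end

theory Submission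
  imports Defs
begin

text \<open>
  Put \<open>w\<^sub>i = - ln (1 - p\<^sub>i) > 0\<close>. The payoff of user \<open>n\<close> is a term depending on its own action
  only, minus the sum of \<open>w\<^sub>i\<close> over the users \<open>i\<close> it interferes with, and interference is a
  symmetric relation. Multiplying the payoff of user \<open>n\<close> by \<open>w\<^sub>n\<close> makes the interaction terms
  \<open>w\<^sub>n w\<^sub>i\<close> symmetric, so the game has a weighted potential. Every better response update
  raises the potential, which takes only finitely many values.
\<close>

lemma better_response_update_in_PiE:
  assumes "better_response_update I S u s s'"
  shows "s' \<in> Pi\<^sub>E I S"
  using assms unfolding better_response_update_def
  by (auto simp: PiE_iff extensional_def)

lemma nash_equilibrium_iff_no_better_response:
  assumes "s \<in> Pi\<^sub>E I S"
  shows "nash_equilibrium I S u s \<longleftrightarrow> (\<nexists>s'. better_response_update I S u s s')"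
  using assms
  unfolding nash_equilibrium_def better_response_update_def is_arg_max_def
  by (auto simp: PiE_iff)

lemma better_response_process_in_PiE:
  assumes "better_response_process I S u f"
  shows "f t \<in> Pi\<^sub>E I S"
proof (induction t)
  case 0
  show ?case using assms by (simp add: better_response_process_def)
next
  case (Suc t)
  then show ?case using assms better_response_update_in_PiE
    by (metis better_response_process_def)
qed

text \<open>A maximiser of \<open>\<Phi>\<close> over the finite nonempty profile set admits no
  better response, since an update would lead to another profile with a larger value.\<close>

lemma nash_equilibrium_exists_if_potential:
  fixes \<Phi> :: "('i \<Rightarrow> 'x) \<Rightarrow> real"
  assumes fin: "finite (Pi\<^sub>E I S)" and ne: "Pi\<^sub>E I S \<noteq> {}"
    and pot: "\<And>s s'. better_response_update I S u s s' \<Longrightarrow> \<Phi> s < \<Phi> s'"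
  shows "\<exists>s. nash_equilibrium I S u s"
proof -
  have "Max (\<Phi> ` Pi\<^sub>E I S) \<in> \<Phi> ` Pi\<^sub>E I S"
    using fin ne by (intro Max_in) auto
  then obtain s where s: "s \<in> Pi\<^sub>E I S" "\<Phi> s = Max (\<Phi> ` Pi\<^sub>E I S)"
    by (metis imageE)
  then have "\<Phi> s' \<le> \<Phi> s" if "s' \<in> Pi\<^sub>E I S" for s'
    using that fin by simp
  then have "\<not> better_response_update I S u s s'" for s'
    using pot better_response_update_in_PiE by (metis leD)
  then show ?thesis
    using nash_equilibrium_iff_no_better_response s(1) by blast
qed

text \<open>Along a process \<open>\<Phi>\<close> never decreases and rises at each update, so
  distinct update slots have distinct values of \<open>\<Phi>\<close>, of which there are finitely
  many.\<close>

lemma finite_improvement_property_if_potential: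
  fixes \<Phi> :: "('i \<Rightarrow> 'x) \<Rightarrow> real"
  assumes fin: "finite (Pi\<^sub>E I S)"
    and pot: "\<And>s s'. better_response_update I S u s s' \<Longrightarrow> \<Phi> s < \<Phi> s'"
  shows "finite_improvement_property I S u"
  unfolding finite_improvement_property_def
proof (intro allI impI conjI)
  fix f assume f: "better_response_process I S u f"
  let ?A = "{t. f (Suc t) \<noteq> f t}"
  have inP: "f t \<in> Pi\<^sub>E I S" for t
    using better_response_process_in_PiE[OF f] .
  have up: "\<Phi> (f t) < \<Phi> (f (Suc t))" if "t \<in> ?A" for t
    using that f pot by (auto simp: better_response_process_def)
  have "incseq (\<lambda>t. \<Phi> (f t))"
  proof (rule incseq_SucI)
    show "\<Phi> (f t) \<le> \<Phi> (f (Suc t))" for t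
      using up[of t] by (cases "t \<in> ?A") auto
  qed
  \<comment> \<open>The strict rise happens from \<open>t\<close> to \<open>Suc t\<close>;
    monotonicity carries it on to \<open>t'\<close>.\<close>
  then have less: "\<Phi> (f t) < \<Phi> (f t')" if "t \<in> ?A" "t < t'" for t t'
    using up[OF that(1)] that(2) by (meson Suc_leI incseqD less_le_trans)
  have "inj_on (\<lambda>t. \<Phi> (f t)) ?A"
    by (rule linorder_inj_onI) (use less in fastforce)+
  moreover have "(\<lambda>t. \<Phi> (f t)) ` ?A \<subseteq> \<Phi> ` Pi\<^sub>E I S"
    using inP by blast
  ultimately show finA: "finite ?A"
    using fin by (meson finite_imageI inj_on_finite)
  assume live: "\<forall>t. (\<exists>s'. better_response_update I S u (f t) s') \<longrightarrow> (\<exists>t'\<ge>t. f (Suc t') \<noteq> f t')"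
  obtain T where "\<forall>t\<in>?A. t < T"
    using finA finite_nat_set_iff_bounded by blast
  then have idle: "f (Suc t) = f t" if "t \<ge> T" for t
    using that by fastforce
  have "f t = f T" if "t \<ge> T" for t
    using that by (induction t rule: dec_induct) (simp_all add: idle)
  \<comment> \<open>A better response at \<open>f T\<close> would, by \<open>live\<close>, force an
    update at some slot from \<open>T\<close> on, against \<open>idle\<close>.\<close>
  moreover have "nash_equilibrium I S u (f T)"
    using live idle nash_equilibrium_iff_no_better_response[OF inP] by blast
  ultimately show "\<exists>T. nash_equilibrium I S u (f T) \<and> (\<forall>t\<ge>T. f t = f T)"
    by blast
qed

text \<open>An abstract congestion-type payoff: for symmetric \<open>g\<close>, the weight
  \<open>w j\<close> alone makes the effect of \<open>j\<close> on \<open>i\<close> differ from that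
  of \<open>i\<close> on \<open>j\<close>.\<close>

definition pairwise_payoff ::
  "'i set \<Rightarrow> ('i \<Rightarrow> real) \<Rightarrow> ('i \<Rightarrow> 'x \<Rightarrow> real) \<Rightarrow> ('x \<Rightarrow> 'x \<Rightarrow> real) \<Rightarrow> 'i \<Rightarrow> ('i \<Rightarrow> 'x) \<Rightarrow> real" where
  "pairwise_payoff I w c g i s = c i (s i) - (\<Sum>j\<in>I - {i}. w j * g (s i) (s j))"

text \<open>The double sum runs over ordered pairs, so halving it counts each unordered pair once
  when \<open>g\<close> is symmetric.\<close>

definition pairwise_potential ::
  "'i set \<Rightarrow> ('i \<Rightarrow> real) \<Rightarrow> ('i \<Rightarrow> 'x \<Rightarrow> real) \<Rightarrow> ('x \<Rightarrow> 'x \<Rightarrow> real) \<Rightarrow> ('i \<Rightarrow> 'x) \<Rightarrow> real" where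
  "pairwise_potential I w c g s =
     (\<Sum>i\<in>I. w i * c i (s i)) - (\<Sum>i\<in>I. \<Sum>j\<in>I - {i}. w i * w j * g (s i) (s j)) / 2"

text \<open>Player \<open>i\<close> occurs in the double sum once as first and once as second index.
  By symmetry both contributions agree, which cancels the half; what remains does not involve
  \<open>s i\<close>.\<close>

lemma pairwise_potential_remove:
  assumes fin: "finite I" and i: "i \<in> I" and sym: "\<And>x y. g x y = g y x"
  shows "pairwise_potential I w c g s =
    w i * pairwise_payoff I w c g i s + pairwise_potential (I - {i}) w c g s"
proof -
  define h where "h k j = w k * w j * g (s k) (s j)" for k j
  \<comment> \<open>This is where scaling by the player's own weight pays off:
    \<open>w k * w j\<close> is symmetric, unlike \<open>w j\<close> alone.\<close>
  have h_sym: "h k j = h j k" for k j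
    by (simp add: h_def sym[of "s k"] mult.commute)
  \<comment> \<open>Extracts the term with second index \<open>i\<close> from each of the other
    rows, flipped by \<open>h_sym\<close> to match row \<open>i\<close>.\<close>
  have "(\<Sum>j\<in>I - {k}. h k j) = h i k + (\<Sum>j\<in>I - {i} - {k}. h k j)" if "k \<in> I - {i}" for k
  proof -
    have "I - {k} - {i} = I - {i} - {k}" by blast
    then show ?thesis
      using sum.remove[of "I - {k}" i "h k"] fin i that by (auto simp: h_sym[of k i])
  qed
  then have "(\<Sum>k\<in>I. \<Sum>j\<in>I - {k}. h k j) =
      (\<Sum>j\<in>I - {i}. h i j) + (\<Sum>k\<in>I - {i}. h i k + (\<Sum>j\<in>I - {i} - {k}. h k j))"
    by (simp add: sum.remove[OF fin i])
  also have "\<dots> = 2 * (\<Sum>j\<in>I - {i}. h i j) + (\<Sum>k\<in>I - {i}. \<Sum>j\<in>I - {i} - {k}. h k j)"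
    by (simp add: sum.distrib)
  finally have double: "(\<Sum>k\<in>I. \<Sum>j\<in>I - {k}. h k j) = \<dots>" .
  have "w i * pairwise_payoff I w c g i s = w i * c i (s i) - (\<Sum>j\<in>I - {i}. h i j)"
    by (simp add: pairwise_payoff_def h_def right_diff_distrib sum_distrib_left mult.assoc)
  then show ?thesis
    using double by (simp add: pairwise_potential_def sum.remove[OF fin i] add_divide_distrib
      flip: h_def)
qed

lemma pairwise_potential_cong:
  assumes "\<And>i. i \<in> I \<Longrightarrow> s i = s' i"
  shows "pairwise_potential I w c g s = pairwise_potential I w c g s'"
  unfolding pairwise_potential_def using assms by (auto intro!: arg_cong2[where f = "(-)"] sum.cong)

text \<open>When \<open>i\<close> deviates, the potential of the other players is unchanged, so the
  total changes by \<open>w i > 0\<close> times the change in the payoff of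
  \<open>i\<close>.\<close>

lemma pairwise_potential_less:
  assumes fin: "finite I" and w: "\<And>i. i \<in> I \<Longrightarrow> w i > 0" and sym: "\<And>x y. g x y = g y x"
    and upd: "better_response_update I S (pairwise_payoff I w c g) s s'"
  shows "pairwise_potential I w c g s < pairwise_potential I w c g s'"
proof -
  obtain i x where i: "i \<in> I" "s' = s(i := x)"
    and less: "pairwise_payoff I w c g i s < pairwise_payoff I w c g i s'"
    using upd by (auto simp: better_response_update_def)
  have "pairwise_potential (I - {i}) w c g s = pairwise_potential (I - {i}) w c g s'"
    by (rule pairwise_potential_cong) (simp add: i(2))
  then show ?thesis
    using less w[OF i(1)]
    by (simp add: pairwise_potential_remove[OF fin i(1), of g, OF sym])
qed

text \<open>Agreement on feasible profiles suffices because both ends of an update are feasible. The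
  logarithmic payoff is put in pairwise form only there.\<close>

lemma better_response_update_cong:
  assumes "\<And>i s. i \<in> I \<Longrightarrow> s \<in> Pi\<^sub>E I S \<Longrightarrow> u i s = v i s"
    and upd: "better_response_update I S u s s'"
  shows "better_response_update I S v s s'"
  using assms better_response_update_in_PiE[OF upd]
  unfolding better_response_update_def by metis

text \<open>A numeric indicator lets the profile-dependent set of interferers be replaced by a sum
  over the fixed set of all other users.\<close>

definition interference ::
  "('l \<Rightarrow> 'l \<Rightarrow> real) \<Rightarrow> real \<Rightarrow> 'l \<times> nat \<Rightarrow> 'l \<times> nat \<Rightarrow> real" where
  "interference ds \<delta> x y = of_bool (snd y = snd x \<and> ds (fst y) (fst x) \<le> \<delta>)"

text \<open>The logarithm turns the product over interferers into a sum; \<open>pos\<close> and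
  \<open>p i < 1\<close> make both factors positive, so it may be split.\<close>

lemma joint_payoff_eq_pairwise_payoff:
  assumes n: "n \<in> {1..N}"
    and p: "\<And>i. i \<in> {1..N} \<Longrightarrow> p i < 1"
    and pos: "\<theta> (snd (s n)) * B (snd (s n)) (fst (s n)) n * p n > 0"
  shows "joint_payoff N ds \<delta> \<theta> B p n s =
    pairwise_payoff {1..N} (\<lambda>i. - ln (1 - p i)) (\<lambda>n x. ln (\<theta> (snd x) * B (snd x) (fst x) n * p n))
      (interference ds \<delta>) n s"
proof -
  let ?C = "cochannel_neighbours N ds \<delta> (\<lambda>i. fst (s i)) (\<lambda>i. snd (s i)) n"
  have C: "?C = {j \<in> {1..N} - {n}. snd (s j) = snd (s n) \<and> ds (fst (s j)) (fst (s n)) \<le> \<delta>}"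
    by (auto simp: cochannel_neighbours_def neighbours_def)
  have lt: "p i < 1" if "i \<in> ?C" for i
    using p that by (simp add: C)
  then have "(\<Prod>i\<in>?C. 1 - p i) > 0"
    by (intro prod_pos) simp
  moreover have "ln (\<Prod>i\<in>?C. 1 - p i) = (\<Sum>i\<in>?C. ln (1 - p i))"
    using lt by (intro ln_prod) (simp_all add: C, force)
  \<comment> \<open>The added terms vanish because the indicator is 0 outside
    \<open>?C\<close>.\<close>
  moreover have "(\<Sum>i\<in>?C. ln (1 - p i)) =
      (\<Sum>j\<in>{1..N} - {n}. ln (1 - p j) * interference ds \<delta> (s n) (s j))"
    by (rule sum.mono_neutral_cong_left) (auto simp: C interference_def)
  ultimately show ?thesis
    using pos
    by (simp add: joint_payoff_def payoff_def pairwise_payoff_def ln_mult_pos sum_negf)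
qed

theorem theorem5:
  fixes N M :: nat
    and \<Delta> :: "'l set" and \<Delta>s :: "nat \<Rightarrow> 'l set"
    and ds :: "'l \<Rightarrow> 'l \<Rightarrow> real" and \<delta> :: real
    and \<theta> :: "nat \<Rightarrow> real" and B :: "nat \<Rightarrow> 'l \<Rightarrow> nat \<Rightarrow> real"
    and p :: "nat \<Rightarrow> real" and p_min p_max :: real
  assumes "M \<ge> 1"
    and "finite \<Delta>" and "Metric_space \<Delta> ds"
    and "\<And>n. n \<in> {1..N} \<Longrightarrow> \<Delta>s n \<subseteq> \<Delta> \<and> \<Delta>s n \<noteq> {}"
    and "\<And>m. m \<in> {1..M} \<Longrightarrow> 0 < \<theta> m \<and> \<theta> m < 1"
    and "\<And>m l n. m \<in> {1..M} \<Longrightarrow> n \<in> {1..N} \<Longrightarrow> l \<in> \<Delta>s n \<Longrightarrow> 0 < B m l n"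
    and "0 < p_min" and "p_min < p_max" and "p_max < 1"
    and "\<And>n. n \<in> {1..N} \<Longrightarrow> p_min < p n \<and> p n < p_max"
  shows "(\<exists>s. nash_equilibrium {1..N} (joint_actions M \<Delta>s) (joint_payoff N ds \<delta> \<theta> B p) s) \<and>
         finite_improvement_property {1..N} (joint_actions M \<Delta>s) (joint_payoff N ds \<delta> \<theta> B p)"
proof -
  let ?S = "joint_actions M \<Delta>s" and ?u = "joint_payoff N ds \<delta> \<theta> B p"
  let ?w = "\<lambda>i. - ln (1 - p i)"
    and ?c = "\<lambda>n x. ln (\<theta> (snd x) * B (snd x) (fst x) n * p n)"
    and ?g = "interference ds \<delta>"
  have fin: "finite (Pi\<^sub>E {1..N} ?S)"
    using assms(2,4) finite_subset
    by (fastforce simp: joint_actions_def intro!: finite_PiE finite_cartesian_product)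
  have ne: "Pi\<^sub>E {1..N} ?S \<noteq> {}"
    using assms(1,4) by (auto simp: joint_actions_def PiE_eq_empty_iff)
  have p: "0 < p i" "p i < 1" if "i \<in> {1..N}" for i
    using assms(7,9) assms(10)[OF that] by linarith+
  have w: "?w i > 0" if "i \<in> {1..N}" for i
    using p[OF that] by simp
  \<comment> \<open>Symmetry of the distance is available for arbitrary points, so no membership in
    \<open>\<Delta>\<close> has to be checked.\<close>
  have sym: "?g x y = ?g y x" for x y
    using Metric_space.commute[OF assms(3), of "fst x" "fst y"] by (simp add: interference_def eq_commute)
  have eq: "?u n s = pairwise_payoff {1..N} ?w ?c ?g n s"
    if n: "n \<in> {1..N}" and s: "s \<in> Pi\<^sub>E {1..N} ?S" for n s
  proof (rule joint_payoff_eq_pairwise_payoff[OF n p(2)])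
    have "snd (s n) \<in> {1..M}" "fst (s n) \<in> \<Delta>s n"
      using PiE_mem[OF s n] by (auto simp: joint_actions_def)
    then show "\<theta> (snd (s n)) * B (snd (s n)) (fst (s n)) n * p n > 0"
      using assms(5,6) n p(1) by simp
  qed
  have pot: "pairwise_potential {1..N} ?w ?c ?g s < pairwise_potential {1..N} ?w ?c ?g s'"
    if "better_response_update {1..N} ?S ?u s s'" for s s'
    using pairwise_potential_less[OF _ w sym better_response_update_cong[OF eq that]] by simp
  show ?thesis
    using nash_equilibrium_exists_if_potential[OF fin ne]
      finite_improvement_property_if_potential[OF fin] pot by blast
qed

end
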